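(* Assume that $f$ is endowed with the inexact first-order oracle described in the context and that there exists a number $\psi^*>-\infty$ such that $\psi(x)\ge\psi^*$ for all $x\in X$. Then after $M$ iterations (outer iterations $k=0,\dots,M$) of the adaptive projected gradient algorithm described in the context it holds that $$\|M_K(x_K-x_{K+1})\|^2\le\frac{4L(\psi(x_0)-\psi^* )}{M+1}+\frac\varepsilon2.$$ Moreover, the total number of inner steps is no more than $M+\log_2\frac{2L}{L_0}$.
   Context: $\mathcal{E}$ is a finite-dimensional real vector space with norm $\|\cdot\|$ and dual $\mathcal{E}^*$. The problem is $\min_{x\in X}\{\psi(x):=f(x)+h(x)\}$, $X\subset\mathcal{E}$ closed convex, $h$ a simple convex function, $f$ a general (possibly non-convex) function. Inexact first-order oracle: there is $L\in(0,\infty)$ such that for any $\delta\ge0$ and any $x\in X$ one can calculate $\tilde f(x,\delta)\in\mathbb{R}$ and $\tilde g(x,\delta)\in\mathcal{E}^*$ satisfying, for all $y\in X$, $$|f(y)-(\tilde f(x,\delta)+\langle\tilde g(x,\delta),y-x\rangle)|\le\frac L2\|x-y\|^2+\delta.$$ Prox-function $d$: continuously differentiable and $1$-strongly convex on $X$ w.r.t. $\|\cdot\|$; $V(x,z)=d(x)-d(z)-\langle\nabla d(z),x-z\rangle$. Adaptive projected gradient algorithm: input $x_0\in X$, $L_0>0$, accuracy $\varepsilon>0$. Set $k=0$, $z=+\infty$. Outer loop (iteration $k$): set $M_k=L_k$. Inner loop (each pass is an inner step): set $\delta=\frac\varepsilon{16M_k}$, compute $\tilde f(x_k,\delta),\tilde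 g(x_k,\delta)$ and $w_k=\arg\min_{x\in X}\{\langle\tilde g(x_k,\delta),x\rangle+M_kV(x,x_k)+h(x)\}$; if $$\tilde f(w_k,\delta)\le\tilde f(x_k,\delta)+\langle\tilde g(x_k,\delta),w_k-x_k\rangle+\frac{M_k}2\|w_k-x_k\|^2+\frac\varepsilon{8M_k},$$ leave the inner loop, otherwise replace $M_k$ by $2M_k$ and repeat. Then set $x_{k+1}=w_k$, $L_{k+1}=M_k/2$; if $\|M_k(x_k-x_{k+1})\|<z$, set $z=\|M_k(x_k-x_{k+1})\|$ and $K=k$; set $k=k+1$. The algorithm stops when $z\le\varepsilon$ and outputs $x_{K+1}$. Thus $K$ is the index of the smallest value $\|M_k(x_k-x_{k+1})\|$ observed so far.
   Formalization: The formal theorem additionally assumes L_0 ≤ 2L (both bounds can fail otherwise), and its bound M + log2(2L/L_0) counts only the inner steps beyond the first in each outer iteration, since counting every pass makes the stated bound false. *)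

theory Defs
  imports "HOL-Analysis.Analysis"
begin

text \<open>
  The space \<open>\<E>\<close> is a type of class \<^class>\<open>real_normed_vector\<close>; its norm need not come from an inner
  product, so \<open>euclidean_space\<close> would be too special.  The dual is \<^typ>\<open>'a \<Rightarrow>\<^sub>L real\<close>.
\<close>

definition finite_dimensional :: "'a::real_vector itself \<Rightarrow> bool" where
  "finite_dimensional _ \<longleftrightarrow> (\<exists>B::'a set. finite B \<and> span B = UNIV)"

definition strongly_convex_on :: "real \<Rightarrow> 'a::real_normed_vector set \<Rightarrow> ('a \<Rightarrow> real) \<Rightarrow> bool" where
  "strongly_convex_on \<mu> X d \<longleftrightarrow> convex X \<and>
     (\<forall>x\<in>X. \<forall>y\<in>X. \<forall>t\<in>{0..1}.
        d ((1 - t) *\<^sub>R x + t *\<^sub>R y)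
          \<le> (1 - t) * d x + t * d y - \<mu> / 2 * t * (1 - t) * (norm (x - y))\<^sup>2)"

text \<open>
  The gradient \<open>d'\<close> is an explicit argument: if \<open>X\<close> has empty interior, derivatives within \<open>X\<close> are not
  unique.  On vectors \<open>x - z\<close> with \<open>x, z \<in> X\<close> they all agree, so \<open>bregman\<close> below does not depend on
  the choice.
\<close>

definition prox_function ::
  "'a::real_normed_vector set \<Rightarrow> ('a \<Rightarrow> real) \<Rightarrow> ('a \<Rightarrow> 'a \<Rightarrow>\<^sub>L real) \<Rightarrow> bool" where
  "prox_function X d d' \<longleftrightarrow>
     (\<forall>z\<in>X. (d has_derivative blinfun_apply (d' z)) (at z within X)) \<and>
     continuous_on X d' \<and> strongly_convex_on 1 X d"

definition bregman ::
  "('a::real_normed_vector \<Rightarrow> real) \<Rightarrow> ('a \<Rightarrow> 'a \<Rightarrow>\<^sub>L real) \<Rightarrow> 'a \<Rightarrow> 'a \<Rightarrow> real" where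
  "bregman d d' x z = d x - d z - blinfun_apply (d' z) (x - z)"

definition inexact_oracle ::
  "'a::real_normed_vector set \<Rightarrow> ('a \<Rightarrow> real) \<Rightarrow> real
     \<Rightarrow> ('a \<Rightarrow> real \<Rightarrow> real) \<Rightarrow> ('a \<Rightarrow> real \<Rightarrow> 'a \<Rightarrow>\<^sub>L real) \<Rightarrow> bool" where
  "inexact_oracle X f L ft gt \<longleftrightarrow>
     (\<forall>\<delta>\<ge>0. \<forall>x\<in>X. \<forall>y\<in>X.
        \<bar>f y - (ft x \<delta> + blinfun_apply (gt x \<delta>) (y - x))\<bar> \<le> L / 2 * (norm (x - y))\<^sup>2 + \<delta>)"

definition prox_step ::
  "'a::real_normed_vector set \<Rightarrow> ('a \<Rightarrow> real) \<Rightarrow> ('a \<Rightarrow> real) \<Rightarrow> ('a \<Rightarrow> 'a \<Rightarrow>\<^sub>L real)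
     \<Rightarrow> ('a \<Rightarrow> real \<Rightarrow> 'a \<Rightarrow>\<^sub>L real) \<Rightarrow> real \<Rightarrow> real \<Rightarrow> 'a \<Rightarrow> 'a \<Rightarrow> bool" where
  "prox_step X h d d' gt \<delta> M x w \<longleftrightarrow>
     is_arg_min (\<lambda>u. blinfun_apply (gt x \<delta>) u + M * bregman d d' u x + h u) (\<lambda>u. u \<in> X) w"

definition accepted ::
  "('a::real_normed_vector \<Rightarrow> real \<Rightarrow> real) \<Rightarrow> ('a \<Rightarrow> real \<Rightarrow> 'a \<Rightarrow>\<^sub>L real)
     \<Rightarrow> real \<Rightarrow> real \<Rightarrow> real \<Rightarrow> 'a \<Rightarrow> 'a \<Rightarrow> bool" where
  "accepted ft gt \<epsilon> \<delta> M x w \<longleftrightarrow>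
     ft w \<delta> \<le> ft x \<delta> + blinfun_apply (gt x \<delta>) (w - x) + M / 2 * (norm (w - x))\<^sup>2 + \<epsilon> / (8 * M)"

text \<open>
  A state of the execution, between two passes of the inner loop, with its history: \<open>iter\<close> is the index
  \<open>k\<close> of the outer iteration that is about to start or in progress (iterations \<open>0, \<dots>, k - 1\<close> are
  complete); \<open>pt j\<close> is \<open>x\<^sub>j\<close> for \<open>j \<le> k\<close>; \<open>coef j\<close> is the final value of \<open>M\<^sub>j\<close> for \<open>j < k\<close>, and
  \<open>coef k\<close> is the current value of \<open>M\<^sub>k\<close>; \<open>zval\<close> and \<open>best\<close> are the variables \<open>z\<close> and \<open>K\<close>;
  \<open>passes j\<close> counts the passes of the inner loop made so far in outer iteration \<open>j\<close>.
\<close>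

record 'a apg_state =
  iter :: nat
  pt :: "nat \<Rightarrow> 'a"
  coef :: "nat \<Rightarrow> real"
  zval :: ereal
  best :: nat
  passes :: "nat \<Rightarrow> nat"

text \<open>
  The values of the histories at indices above \<open>iter\<close> (and the initial value of \<open>best\<close>, which the first
  completed iteration overwrites because \<open>zval = \<infinity>\<close>) are never read.
\<close>

definition apg_init :: "'a \<Rightarrow> real \<Rightarrow> 'a apg_state" where
  "apg_init x0 L0 =
     \<lparr>iter = 0, pt = (\<lambda>_. x0), coef = (\<lambda>_. L0), zval = \<infinity>, best = 0, passes = (\<lambda>_. 0)\<rparr>"

text \<open>
  One pass of the inner loop.  The guard \<open>ereal \<epsilon> < zval s\<close> is the negated stopping criterion \<open>z \<le> \<epsilon>\<close>;
  \<open>zval\<close> changes only when an outer iteration is completed.  The rule \<open>accept\<close> also completes the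
  outer iteration, and sets \<open>M\<^bsub>k+1\<^esub> = L\<^bsub>k+1\<^esub> = M\<^sub>k / 2\<close>.
\<close>

inductive apg_step ::
  "'a::real_normed_vector set \<Rightarrow> ('a \<Rightarrow> real) \<Rightarrow> ('a \<Rightarrow> real) \<Rightarrow> ('a \<Rightarrow> 'a \<Rightarrow>\<^sub>L real)
     \<Rightarrow> ('a \<Rightarrow> real \<Rightarrow> real) \<Rightarrow> ('a \<Rightarrow> real \<Rightarrow> 'a \<Rightarrow>\<^sub>L real) \<Rightarrow> real
     \<Rightarrow> 'a apg_state \<Rightarrow> 'a apg_state \<Rightarrow> bool"
  for X h d d' ft gt \<epsilon> where
  reject:
    "\<lbrakk>ereal \<epsilon> < zval s; k = iter s; x = pt s k; M = coef s k; \<delta> = \<epsilon> / (16 * M);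
      prox_step X h d d' gt \<delta> M x w; \<not> accepted ft gt \<epsilon> \<delta> M x w\<rbrakk>
     \<Longrightarrow> apg_step X h d d' ft gt \<epsilon> s
           (s\<lparr>coef := (coef s)(k := 2 * M), passes := (passes s)(k := Suc (passes s k))\<rparr>)"
| accept:
    "\<lbrakk>ereal \<epsilon> < zval s; k = iter s; x = pt s k; M = coef s k; \<delta> = \<epsilon> / (16 * M);
      prox_step X h d d' gt \<delta> M x w; accepted ft gt \<epsilon> \<delta> M x w;
      r = ereal (norm (M *\<^sub>R (x - w)))\<rbrakk>
     \<Longrightarrow> apg_step X h d d' ft gt \<epsilon> s
           (s\<lparr>iter := Suc k,
              pt := (pt s)(Suc k := w),
              coef := (coef s)(Suc k := M / 2),
              zval := (if r < zval s then r else zval s),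
              best := (if r < zval s then k else best s),
              passes := (passes s)(k := Suc (passes s k))\<rparr>)"

definition apg_reachable ::
  "'a::real_normed_vector set \<Rightarrow> ('a \<Rightarrow> real) \<Rightarrow> ('a \<Rightarrow> real) \<Rightarrow> ('a \<Rightarrow> 'a \<Rightarrow>\<^sub>L real)
     \<Rightarrow> ('a \<Rightarrow> real \<Rightarrow> real) \<Rightarrow> ('a \<Rightarrow> real \<Rightarrow> 'a \<Rightarrow>\<^sub>L real) \<Rightarrow> real
     \<Rightarrow> 'a \<Rightarrow> real \<Rightarrow> 'a apg_state \<Rightarrow> bool" where
  "apg_reachable X h d d' ft gt \<epsilon> x0 L0 s \<longleftrightarrow> (apg_step X h d d' ft gt \<epsilon>)\<^sup>*\<^sup>* (apg_init x0 L0) s"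

text \<open>
  Passes of the inner loop, in outer iterations \<open>0, \<dots>, M\<close>, beyond the first one of each iteration.
  For completed iterations this equals the number of times that \<open>M\<^sub>k\<close> is replaced by \<open>2 M\<^sub>k\<close> and the loop
  repeats, and the number of all passes is \<open>M + 1\<close> larger.  An iteration that has not started
  contributes \<open>0 - 1 = 0\<close>.
\<close>

definition repeated_passes :: "'a apg_state \<Rightarrow> nat \<Rightarrow> nat" where
  "repeated_passes s M = (\<Sum>k\<le>M. passes s k - 1)"

end

theory Submission
  imports Defs
begin

text \<open>
  Strong convexity of the prox-step objective gives, for \<open>r = \<parallel>w - x\<parallel>\<close>, the bound
  \<open>\<langle>g, w - x\<rangle> + h w - h x \<le> - M r\<^sup>2\<close>: one half of \<open>M r\<^sup>2\<close> comes from \<open>V(w, x) \<ge> r\<^sup>2 / 2\<close>, the other from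
  the quadratic growth of the objective at its minimiser.  Together with the acceptance test and two
  uses of the oracle at the base point (each costing \<open>\<delta>\<close>) this yields
  \<open>(\<parallel>M (x - w)\<parallel>\<^sup>2 - \<epsilon> / 2) / (2 M) \<le> \<psi> x - \<psi> w\<close>.  The test always succeeds when \<open>M \<ge> L\<close>, hence
  \<open>M\<^sub>k \<le> 2 L\<close>; summing over \<open>k\<close> gives the first claim.  The second follows from
  \<open>M\<^sub>j 2\<^sup>j = L\<^sub>0 2\<^sup>n\<close>, where \<open>n\<close> counts the rejected passes in iterations \<open>0, \<dots>, j\<close>.
\<close>

section \<open>Strongly convex functions\<close>

text \<open>On the segment from \<open>z\<close> to \<open>x\<close>, dividing strong convexity by
  \<open>t\<close> bounds the difference quotient of \<open>d\<close>; then \<open>t\<close> tends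
  to 0 from the right. The segment lies in \<open>X\<close>, so the derivative within
  \<open>X\<close> suffices.\<close>

lemma strongly_convex_on_gradient_inequality:
  fixes d :: "'a::real_normed_vector \<Rightarrow> real"
  assumes sc: "strongly_convex_on \<mu> X d"
    and der: "(d has_derivative D) (at z within X)"
    and z: "z \<in> X" and x: "x \<in> X"
  shows "d z + D (x - z) + \<mu> / 2 * (norm (x - z))\<^sup>2 \<le> d x"
proof -
  define p where "p t = z + t *\<^sub>R (x - z)" for t :: real
  have p_eq: "p t = (1 - t) *\<^sub>R z + t *\<^sub>R x" for t
    by (simp add: p_def algebra_simps)
  have sub: "p ` {0..1} \<subseteq> X"
    using sc x z by (auto simp: p_eq strongly_convex_on_def convex_alt)
  have "(p has_derivative (\<lambda>t. t *\<^sub>R (x - z))) (at 0 within {0..1})"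
    unfolding p_def by (auto intro!: derivative_eq_intros)
  moreover have "(d has_derivative D) (at (p 0) within p ` {0..1})"
    using has_derivative_subset[OF der sub] by (simp add: p_def)
  ultimately have "((\<lambda>t. d (p t)) has_derivative (\<lambda>t. D (t *\<^sub>R (x - z)))) (at 0 within {0..1})"
    by (rule has_derivative_in_compose)
  moreover have "D (t *\<^sub>R (x - z)) = D (x - z) * t" for t
    using linear_scale[OF has_derivative_linear[OF der]] by simp
  ultimately have "((\<lambda>t. d (p t)) has_field_derivative D (x - z)) (at 0 within {0..1})"
    by (simp add: has_field_derivative_def)
  then have lim: "((\<lambda>t. (d (p t) - d z) / t) \<longlongrightarrow> D (x - z)) (at_right 0)"
    by (simp add: has_field_derivative_iff at_within_Icc_at_right p_def)
  \<comment> \<open>The \<open>1 - 0\<close> stays unsimplified: \<open>tendsto_intros\<close>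
    builds the limit in this shape.\<close>
  have lim': "((\<lambda>t. d x - d z - \<mu> / 2 * (1 - t) * (norm (z - x))\<^sup>2)
      \<longlongrightarrow> d x - d z - \<mu> / 2 * (1 - 0) * (norm (z - x))\<^sup>2) (at_right 0)"
    by (intro tendsto_intros)
  have "D (x - z) \<le> d x - d z - \<mu> / 2 * (1 - 0) * (norm (z - x))\<^sup>2"
  proof (rule tendsto_le[OF trivial_limit_at_right_real lim' lim])
    have "(d (p t) - d z) / t \<le> d x - d z - \<mu> / 2 * (1 - t) * (norm (z - x))\<^sup>2"
      if "t \<in> {0<..<1}" for t
    proof -
      have "d (p t) \<le> (1 - t) * d z + t * d x - \<mu> / 2 * t * (1 - t) * (norm (z - x))\<^sup>2"
        using sc x z that by (simp add: strongly_convex_on_def p_eq)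
      then have "d (p t) - d z \<le> (d x - d z - \<mu> / 2 * (1 - t) * (norm (z - x))\<^sup>2) * t"
        by (simp add: algebra_simps)
      then show ?thesis
        using that by (simp add: pos_divide_le_eq)
    qed
    then show "\<forall>\<^sub>F t in at_right 0.
        (d (p t) - d z) / t \<le> d x - d z - \<mu> / 2 * (1 - t) * (norm (z - x))\<^sup>2"
      by (rule eventually_at_right_real[THEN eventually_mono, rotated]) auto
  qed
  then show ?thesis
    by (simp add: norm_minus_commute)
qed

text \<open>Minimality is tested at points of the segment from \<open>w\<close> to \<open>x\<close>;
  divide by \<open>t\<close> and let it tend to 0. Only values of \<phi> enter, so a nonsmooth
  \<open>h\<close> is covered.\<close>

lemma strongly_convex_on_arg_min_growth:
  fixes \<phi> :: "'a::real_normed_vector \<Rightarrow> real"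
  assumes sc: "strongly_convex_on \<mu> X \<phi>"
    and w: "is_arg_min \<phi> (\<lambda>u. u \<in> X) w" and x: "x \<in> X"
  shows "\<phi> w + \<mu> / 2 * (norm (x - w))\<^sup>2 \<le> \<phi> x"
proof -
  have wX: "w \<in> X" and min: "\<And>u. u \<in> X \<Longrightarrow> \<phi> w \<le> \<phi> u"
    using w by (auto simp: is_arg_min_linorder)
  have lim: "((\<lambda>t. \<phi> w + \<mu> / 2 * (1 - t) * (norm (w - x))\<^sup>2)
      \<longlongrightarrow> \<phi> w + \<mu> / 2 * (1 - 0) * (norm (w - x))\<^sup>2) (at_right 0)"
    by (intro tendsto_intros)
  have "\<phi> w + \<mu> / 2 * (1 - 0) * (norm (w - x))\<^sup>2 \<le> \<phi> x"
  proof (rule tendsto_upperbound[OF lim _ trivial_limit_at_right_real])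
    have "\<phi> w + \<mu> / 2 * (1 - t) * (norm (w - x))\<^sup>2 \<le> \<phi> x" if "t \<in> {0<..<1}" for t
    proof -
      have "(1 - t) *\<^sub>R w + t *\<^sub>R x \<in> X"
        using sc wX x that by (simp add: strongly_convex_on_def convex_alt)
      then have "\<phi> w \<le> \<phi> ((1 - t) *\<^sub>R w + t *\<^sub>R x)"
        by (rule min)
      also have "\<dots> \<le> (1 - t) * \<phi> w + t * \<phi> x - \<mu> / 2 * t * (1 - t) * (norm (w - x))\<^sup>2"
        using sc wX x that by (simp add: strongly_convex_on_def)
      finally have "t * (\<phi> w + \<mu> / 2 * (1 - t) * (norm (w - x))\<^sup>2) \<le> t * \<phi> x"
        by (simp add: algebra_simps)
      then show ?thesis
        using that by simp
    qed
    then show "\<forall>\<^sub>F t in at_right 0. \<phi> w + \<mu> / 2 * (1 - t) * (norm (w - x))\<^sup>2 \<le> \<phi> x"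
      by (rule eventually_at_right_real[THEN eventually_mono, rotated]) auto
  qed
  then show ?thesis
    by (simp add: norm_minus_commute)
qed

section \<open>The prox step and the acceptance test\<close>

text \<open>As a function of \<open>u\<close>, the Bregman term is \<open>d\<close> minus an affine
  function, so it keeps the modulus of \<open>d\<close>.\<close>

lemma strongly_convex_on_prox_objective:
  assumes sc: "strongly_convex_on 1 X d" and h: "convex_on X h" and "0 \<le> M"
  shows "strongly_convex_on M X (\<lambda>u. blinfun_apply g u + M * bregman d d' u x + h u)"
  unfolding strongly_convex_on_def
proof (intro conjI ballI)
  show "convex X"
    using sc by (simp add: strongly_convex_on_def)
  fix u v and t :: real
  assume uv: "u \<in> X" "v \<in> X" and t: "t \<in> {0..1}"
  let ?c = "(1 - t) *\<^sub>R u + t *\<^sub>R v"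
  have "d ?c \<le> (1 - t) * d u + t * d v - 1 / 2 * t * (1 - t) * (norm (u - v))\<^sup>2"
    using sc uv t by (simp add: strongly_convex_on_def)
  then have "M * d ?c \<le> M * ((1 - t) * d u + t * d v - 1 / 2 * t * (1 - t) * (norm (u - v))\<^sup>2)"
    using \<open>0 \<le> M\<close> by (rule mult_left_mono)
  moreover have "h ?c \<le> (1 - t) * h u + t * h v"
    using h uv t by (simp add: convex_onD)
  ultimately show "blinfun_apply g ?c + M * bregman d d' ?c x + h ?c
      \<le> (1 - t) * (blinfun_apply g u + M * bregman d d' u x + h u)
        + t * (blinfun_apply g v + M * bregman d d' v x + h v)
        - M / 2 * t * (1 - t) * (norm (u - v))\<^sup>2"
    by (simp add: bregman_def blinfun.bilinear_simps algebra_simps)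
qed

lemma prox_step_inequality:
  assumes "prox_function X d d'" and "convex_on X h" and "0 \<le> M" and "x \<in> X"
    and step: "prox_step X h d d' gt \<delta> M x w"
  shows "blinfun_apply (gt x \<delta>) (w - x) + h w + M * (norm (w - x))\<^sup>2 \<le> h x"
proof -
  have sc: "strongly_convex_on 1 X d"
    and der: "(d has_derivative blinfun_apply (d' x)) (at x within X)"
    using assms(1,4) by (auto simp: prox_function_def)
  have w: "w \<in> X"
    using step by (simp add: prox_step_def is_arg_min_linorder)
  have "M * (1 / 2 * (norm (w - x))\<^sup>2) \<le> M * bregman d d' w x"
    using strongly_convex_on_gradient_inequality[OF sc der \<open>x \<in> X\<close> w] \<open>0 \<le> M\<close>
    by (intro mult_left_mono) (simp_all add: bregman_def)
  \<comment> \<open>Growth is applied from \<open>w\<close> to \<open>x\<close>, where the Bregman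
    term vanishes.\<close>
  then show ?thesis
    using strongly_convex_on_arg_min_growth[OF
        strongly_convex_on_prox_objective[OF sc \<open>convex_on X h\<close> \<open>0 \<le> M\<close>]
        step[unfolded prox_step_def] \<open>x \<in> X\<close>]
    by (simp add: bregman_def blinfun.bilinear_simps norm_minus_commute)
qed

lemma inexact_oracle_at_base_point:
  assumes "inexact_oracle X f L ft gt" and "0 \<le> \<delta>" and "x \<in> X"
  shows "\<bar>f x - ft x \<delta>\<bar> \<le> \<delta>"
  using assms unfolding inexact_oracle_def
  by (metis add.right_neutral blinfun.zero_right cancel_comm_monoid_add_class.diff_cancel
      mult_zero_right norm_zero power_zero_numeral add.left_neutral)

text \<open>One \<delta> pays for the model at \<open>x\<close>, another for replacing
  \<open>f w\<close> by \<open>ft w\<close>. Together they are exactly the slack \<epsilon> / (8 M)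
  of the test.\<close>

lemma accepted_if_coefficient_ge:
  assumes orc: "inexact_oracle X f L ft gt" and "0 < L" and "L \<le> M" and "0 < \<epsilon>"
    and "x \<in> X" and "w \<in> X"
  shows "accepted ft gt \<epsilon> (\<epsilon> / (16 * M)) M x w"
proof -
  let ?\<delta> = "\<epsilon> / (16 * M)"
  have \<delta>: "0 \<le> ?\<delta>"
    using assms by simp
  have "ft w ?\<delta> \<le> f w + ?\<delta>"
    using inexact_oracle_at_base_point[OF orc \<delta> \<open>w \<in> X\<close>] by linarith
  moreover have "\<bar>f w - (ft x ?\<delta> + blinfun_apply (gt x ?\<delta>) (w - x))\<bar>
      \<le> L / 2 * (norm (x - w))\<^sup>2 + ?\<delta>"
    using orc \<delta> \<open>x \<in> X\<close> \<open>w \<in> X\<close> unfolding inexact_oracle_def by blast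
  moreover have "L / 2 * (norm (x - w))\<^sup>2 \<le> M / 2 * (norm (w - x))\<^sup>2"
    using \<open>L \<le> M\<close> by (simp add: norm_minus_commute mult_right_mono)
  moreover have "\<epsilon> / (8 * M) = 2 * ?\<delta>"
    by simp
  ultimately show ?thesis
    unfolding accepted_def by linarith
qed

lemma accepted_step_decrease:
  assumes "prox_function X d d'" and "convex_on X h" and orc: "inexact_oracle X f L ft gt"
    and "0 < M" and "0 < \<epsilon>" and "x \<in> X"
    and step: "prox_step X h d d' gt (\<epsilon> / (16 * M)) M x w"
    and acc: "accepted ft gt \<epsilon> (\<epsilon> / (16 * M)) M x w"
  shows "((norm (M *\<^sub>R (x - w)))\<^sup>2 - \<epsilon> / 2) / (2 * M) \<le> (f x + h x) - (f w + h w)"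
proof -
  let ?\<delta> = "\<epsilon> / (16 * M)"
  have \<delta>: "0 \<le> ?\<delta>"
    using assms by simp
  have w: "w \<in> X"
    using step by (simp add: prox_step_def is_arg_min_linorder)
  have "f w \<le> ft w ?\<delta> + ?\<delta>" "ft x ?\<delta> \<le> f x + ?\<delta>"
    using inexact_oracle_at_base_point[OF orc \<delta> w]
      inexact_oracle_at_base_point[OF orc \<delta> \<open>x \<in> X\<close>] by linarith+
  moreover have "blinfun_apply (gt x ?\<delta>) (w - x) + h w + M * (norm (w - x))\<^sup>2 \<le> h x"
    using prox_step_inequality[OF assms(1,2) _ \<open>x \<in> X\<close> step] \<open>0 < M\<close> by simp
  moreover have "\<epsilon> / (8 * M) = 2 * ?\<delta>"
    by simp
  \<comment> \<open>Of the four \<delta>, two are the slack of the test; passing between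
    \<open>f\<close> and \<open>ft\<close> costs one each at \<open>w\<close> and
    \<open>x\<close>.\<close>
  ultimately have "f w + h w + M / 2 * (norm (w - x))\<^sup>2 \<le> f x + h x + 4 * ?\<delta>"
    using acc unfolding accepted_def by linarith
  moreover have "((norm (M *\<^sub>R (x - w)))\<^sup>2 - \<epsilon> / 2) / (2 * M) = M / 2 * (norm (w - x))\<^sup>2 - 4 * ?\<delta>"
  proof -
    have "(norm (M *\<^sub>R (x - w)))\<^sup>2 = M\<^sup>2 * (norm (w - x))\<^sup>2"
      by (simp only: norm_scaleR power_mult_distrib power2_abs norm_minus_commute)
    then show ?thesis
      using \<open>0 < M\<close> by (simp add: field_simps power2_eq_square)
  qed
  ultimately show ?thesis
    by linarith
qed

section \<open>Invariants of the execution\<close>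

text \<open>The norm of the gradient mapping, meaningful for completed iterations
  \<open>j < iter s\<close>.\<close>

abbreviation grad_norm :: "'a::real_normed_vector apg_state \<Rightarrow> nat \<Rightarrow> real" where
  "grad_norm s j \<equiv> norm (coef s j *\<^sub>R (pt s j - pt s (Suc j)))"

text \<open>\<open>L0 \<le> 2 * L\<close> is the base case of the coefficient bound. If it fails,
  the logarithm in the pass count is negative, and the count already fails for
  \<open>M = 0\<close>.\<close>

locale adaptive_projected_gradient =
  fixes X :: "'a::real_normed_vector set"
    and f h d :: "'a \<Rightarrow> real"
    and d' :: "'a \<Rightarrow> 'a \<Rightarrow>\<^sub>L real"
    and ft :: "'a \<Rightarrow> real \<Rightarrow> real"
    and gt :: "'a \<Rightarrow> real \<Rightarrow> 'a \<Rightarrow>\<^sub>L real"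
    and L L0 \<epsilon> :: real
    and x0 :: 'a
  assumes convex_h: "convex_on X h"
    and prox: "prox_function X d d'"
    and L_pos: "0 < L" and inexact: "inexact_oracle X f L ft gt"
    and x0: "x0 \<in> X" and eps_pos: "0 < \<epsilon>"
    and L0_pos: "0 < L0" and L0_le: "L0 \<le> 2 * L"
begin

abbreviation "reachable \<equiv> apg_reachable X h d d' ft gt \<epsilon> x0 L0"

abbreviation "\<psi> x \<equiv> f x + h x"

text \<open>Induction over runs with the rule variables eliminated and the stopping guard dropped.
  Reachability of \<open>s\<close> is kept, so that earlier invariants can be used in later
  inductions.\<close>

lemma reachable_induct [consumes 1, case_names init reject accept]:
  assumes "reachable s"
    and "P (apg_init x0 L0)"
    and "\<And>s w. \<lbrakk>reachable s; P s;
        prox_step X h d d' gt (\<epsilon> / (16 * coef s (iter s))) (coef s (iter s)) (pt s (iter s)) w;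
        \<not> accepted ft gt \<epsilon> (\<epsilon> / (16 * coef s (iter s))) (coef s (iter s)) (pt s (iter s)) w\<rbrakk>
      \<Longrightarrow> P (s\<lparr>coef := (coef s)(iter s := 2 * coef s (iter s)),
              passes := (passes s)(iter s := Suc (passes s (iter s)))\<rparr>)"
    and "\<And>s w r. \<lbrakk>reachable s; P s;
        prox_step X h d d' gt (\<epsilon> / (16 * coef s (iter s))) (coef s (iter s)) (pt s (iter s)) w;
        accepted ft gt \<epsilon> (\<epsilon> / (16 * coef s (iter s))) (coef s (iter s)) (pt s (iter s)) w;
        r = ereal (norm (coef s (iter s) *\<^sub>R (pt s (iter s) - w)))\<rbrakk>
      \<Longrightarrow> P (s\<lparr>iter := Suc (iter s),
              pt := (pt s)(Suc (iter s) := w),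
              coef := (coef s)(Suc (iter s) := coef s (iter s) / 2),
              zval := (if r < zval s then r else zval s),
              best := (if r < zval s then iter s else best s),
              passes := (passes s)(iter s := Suc (passes s (iter s)))\<rparr>)"
  shows "P s"
  using assms(1) unfolding apg_reachable_def
proof (induction rule: rtranclp_induct)
  case base
  show ?case
    by (rule assms(2))
next
  case (step s s')
  from step(2) show ?case
  proof cases
    case (reject k x M \<delta> w)
    then show ?thesis
      using assms(3)[of s w] step by (simp add: apg_reachable_def)
  next
    case (accept k x M \<delta> w r)
    show ?thesis
      unfolding accept(1,5,3) by (rule assms(4)) (use step accept in \<open>simp_all add: apg_reachable_def\<close>)
  qed
qed

text \<open>A coefficient is doubled only after a rejection, hence only while below
  \<open>L\<close>; acceptance halves it. The case \<open>j = iter s\<close> covers the coefficient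
  in progress.\<close>

lemma reachable_points_coefficients:
  assumes "reachable s" and "j \<le> iter s"
  shows "pt s j \<in> X \<and> 0 < coef s j \<and> coef s j \<le> 2 * L"
  using assms
proof (induction arbitrary: j rule: reachable_induct)
  case init
  then show ?case
    using x0 L0_pos L0_le by (simp add: apg_init_def)
next
  case (reject s w)
  have "w \<in> X"
    using reject.hyps by (simp add: prox_step_def is_arg_min_linorder)
  then have "coef s (iter s) < L"
    using reject.hyps accepted_if_coefficient_ge[OF inexact L_pos _ eps_pos] reject.IH
    by (meson le_refl not_le)
  then show ?case
    using reject.IH reject.prems by auto
next
  case (accept s w r)
  have "w \<in> X"
    using accept.hyps by (simp add: prox_step_def is_arg_min_linorder)
  then show ?case
    using accept.IH[of j] accept.IH[of "iter s"] accept.prems by (auto simp: le_Suc_eq)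
qed

lemma reachable_decrease:
  assumes "reachable s" and "j < iter s"
  shows "((grad_norm s j)\<^sup>2 - \<epsilon> / 2) / (2 * coef s j) \<le> \<psi> (pt s j) - \<psi> (pt s (Suc j))"
  using assms
proof (induction arbitrary: j rule: reachable_induct)
  case init
  then show ?case
    by (simp add: apg_init_def)
next
  case (reject s w)
  then show ?case
    by simp
next
  case (accept s w r)
  have "((norm (coef s (iter s) *\<^sub>R (pt s (iter s) - w)))\<^sup>2 - \<epsilon> / 2) / (2 * coef s (iter s))
      \<le> \<psi> (pt s (iter s)) - \<psi> w"
    using reachable_points_coefficients[OF accept.hyps(1) le_refl] accept.hyps
    by (intro accepted_step_decrease[OF prox convex_h inexact _ eps_pos]) auto
  then show ?case
    using accept.IH[of j] accept.prems by (cases "j = iter s") auto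
qed

lemma reachable_pt_0: "reachable s \<Longrightarrow> pt s 0 = x0"
  by (induction rule: reachable_induct) (simp_all add: apg_init_def)

lemma reachable_zval:
  assumes "reachable s"
  shows "(iter s = 0 \<longrightarrow> zval s = \<infinity>) \<and>
    (0 < iter s \<longrightarrow> best s < iter s \<and> zval s = ereal (grad_norm s (best s))) \<and>
    (\<forall>j < iter s. zval s \<le> ereal (grad_norm s j))"
  using assms
proof (induction rule: reachable_induct)
  case init
  then show ?case
    by (simp add: apg_init_def)
next
  case (reject s w)
  then show ?case
    by auto
next
  case (accept s w r)
  then show ?case
    \<comment> \<open>In the first iteration \<open>zval\<close> is infinite, so any real value
      replaces it and \<open>best\<close> is set.\<close>
    by (cases "iter s = 0") (auto simp: less_Suc_eq intro: order.trans less_imp_le)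
qed

lemma reachable_best_le:
  assumes "reachable s" and "j < iter s"
  shows "grad_norm s (best s) \<le> grad_norm s j"
  using reachable_zval[OF assms(1)] assms(2) by (metis ereal_less_eq(3) gr_zeroI not_less_zero)

section \<open>Rate for the best gradient mapping\<close>

theorem gradient_mapping_bound:
  assumes s: "reachable s" and iter: "iter s = Suc M"
    and bound: "\<And>x. x \<in> X \<Longrightarrow> \<psi>min \<le> \<psi> x"
  shows "(grad_norm s (best s))\<^sup>2 \<le> 4 * L * (\<psi> x0 - \<psi>min) / (real M + 1) + \<epsilon> / 2"
proof -
  let ?G = "(grad_norm s (best s))\<^sup>2 - \<epsilon> / 2"
  have gap: "0 \<le> \<psi> x0 - \<psi>min"
    using bound[OF x0] by simp
  have "?G * (real M + 1) / (4 * L) \<le> \<psi> x0 - \<psi>min"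
  \<comment> \<open>Enlarging the denominator \<open>2 * coef s j\<close> to \<open>4 * L\<close>
    needs a nonnegative numerator. A negative \<open>?G\<close> makes the claim trivial by
    \<open>gap\<close>.\<close>
  proof (cases "0 \<le> ?G")
    case True
    have "?G / (4 * L) \<le> \<psi> (pt s j) - \<psi> (pt s (Suc j))" if j: "j < Suc M" for j
    proof -
      have c: "0 < coef s j" "coef s j \<le> 2 * L"
        using reachable_points_coefficients[OF s, of j] iter j by auto
      have "(grad_norm s (best s))\<^sup>2 \<le> (grad_norm s j)\<^sup>2"
        by (rule power_mono[OF reachable_best_le[OF s]]) (simp_all add: iter j)
      then have le: "?G \<le> (grad_norm s j)\<^sup>2 - \<epsilon> / 2"
        by linarith
      have "?G / (4 * L) \<le> ((grad_norm s j)\<^sup>2 - \<epsilon> / 2) / (2 * coef s j)"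
        by (rule frac_le[OF order_trans[OF True le] le]) (use c in simp_all)
      also have "\<dots> \<le> \<psi> (pt s j) - \<psi> (pt s (Suc j))"
        using reachable_decrease[OF s] iter j by simp
      finally show ?thesis .
    qed
    then have "(\<Sum>j<Suc M. ?G / (4 * L)) \<le> (\<Sum>j<Suc M. \<psi> (pt s j) - \<psi> (pt s (Suc j)))"
      by (intro sum_mono) auto
    also have "\<dots> = \<psi> x0 - \<psi> (pt s (Suc M))"
      by (subst sum_lessThan_telescope') (simp add: reachable_pt_0[OF s])
    also have "\<dots> \<le> \<psi> x0 - \<psi>min"
      using bound[of "pt s (Suc M)"] reachable_points_coefficients[OF s, of "Suc M"] iter by simp
    finally show ?thesis
      by (simp add: algebra_simps)
  next
    case False
    then have "?G * (real M + 1) / (4 * L) \<le> 0"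
      using L_pos by (intro divide_nonpos_pos mult_nonpos_nonneg) auto
    then show ?thesis
      using gap by linarith
  qed
  then have "?G \<le> 4 * L * (\<psi> x0 - \<psi>min) / (real M + 1)"
    using L_pos by (simp add: field_simps)
  then show ?thesis
    by linarith
qed

section \<open>Counting the passes\<close>

lemma reachable_passes_0:
  assumes "reachable s" and "iter s < i"
  shows "passes s i = 0"
  using assms by (induction rule: reachable_induct) (simp_all add: apg_init_def)

text \<open>A completed iteration has one accepted pass, so \<open>passes - 1\<close> doublings; in
  the iteration in progress every pass so far was rejected and counts. The powers of 2 on the right
  undo the halvings between iterations.\<close>

lemma reachable_coefficient_formula:
  assumes "reachable s"
  shows "(\<forall>j < iter s. L0 * 2 ^ repeated_passes s j = coef s j * 2 ^ j) \<and>
    L0 * 2 ^ ((\<Sum>i<iter s. passes s i - 1) + passes s (iter s)) = coef s (iter s) * 2 ^ iter s"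
  using assms
proof (induction rule: reachable_induct)
  case init
  then show ?case
    by (simp add: apg_init_def)
next
  case (reject s w)
  then show ?case
    by (simp add: repeated_passes_def)
next
  case (accept s w r)
  let ?n = "iter s" and ?p = "(passes s)(iter s := Suc (passes s (iter s)))"
  have eq: "(\<Sum>i\<le>j. ?p i - Suc 0) = (\<Sum>i\<le>j. passes s i - Suc 0)" if "j < ?n" for j
    using that by (intro sum.cong) auto
  \<comment> \<open>The accepting pass raises the count by one and the subtraction removes it, so
    the exponent in progress becomes that of a completed iteration.\<close>
  have eq': "(\<Sum>i\<le>?n. ?p i - Suc 0) = (\<Sum>i<?n. passes s i - Suc 0) + passes s ?n"
    by (simp add: lessThan_Suc_atMost[symmetric])
  show ?case
    using accept.IH reachable_passes_0[OF accept.hyps(1), of "Suc ?n"]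
    by (auto simp: repeated_passes_def less_Suc_eq lessThan_Suc_atMost eq eq' fun_upd_same fun_upd_other
        simp del: fun_upd_apply)
qed

text \<open>This holds in the middle of an iteration too, so no inner loop can repeat
  forever.\<close>

theorem repeated_passes_bound:
  assumes s: "reachable s"
  shows "real (repeated_passes s M) \<le> real M + log 2 (2 * L / L0)"
proof -
  \<comment> \<open>The witness is the minimum of \<open>M\<close> and \<open>iter s\<close>. If
    iteration \<open>M\<close> is not complete, iterations after \<open>iter s\<close> contribute 0,
    and \<open>passes - 1 \<le> passes\<close> turns the formula into an inequality.\<close>
  obtain j where j: "j \<le> M" "j \<le> iter s" "L0 * 2 ^ repeated_passes s M \<le> coef s j * 2 ^ j"
  proof (cases "M < iter s")
    case True
    then show thesis
      using that[of M] reachable_coefficient_formula[OF s] by simp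
  next
    case False
    let ?n = "iter s"
    have "repeated_passes s M = (\<Sum>i\<le>?n. passes s i - 1)"
      unfolding repeated_passes_def using False reachable_passes_0[OF s]
      by (intro sum.mono_neutral_right) auto
    also have "\<dots> \<le> (\<Sum>i<?n. passes s i - 1) + passes s ?n"
      by (simp add: lessThan_Suc_atMost[symmetric])
    finally have "L0 * 2 ^ repeated_passes s M
        \<le> L0 * 2 ^ ((\<Sum>i<?n. passes s i - 1) + passes s ?n)"
      using L0_pos by (intro mult_left_mono power_increasing) auto
    then show thesis
      using that[of ?n] False reachable_coefficient_formula[OF s] by simp
  qed
  have "coef s j * 2 ^ j \<le> 2 * L * 2 ^ M"
    using reachable_points_coefficients[OF s j(2)] j(1) L_pos
    by (intro mult_mono power_increasing) auto
  with j(3) have "2 ^ repeated_passes s M \<le> 2 ^ M * (2 * L / L0)"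
    using L0_pos by (simp add: field_simps)
  then have "log 2 (2 ^ repeated_passes s M) \<le> log 2 (2 ^ M * (2 * L / L0))"
    by (intro log_mono) auto
  also have "\<dots> = real M + log 2 (2 * L / L0)"
    using L_pos L0_pos by (subst log_mult_pos) (auto simp: log_nat_power)
  finally show ?thesis
    by (simp add: log_nat_power)
qed

end

theorem theorem2p7:
  fixes X :: "'a::real_normed_vector set"
    and f h d :: "'a \<Rightarrow> real"
    and d' :: "'a \<Rightarrow> 'a \<Rightarrow>\<^sub>L real"
    and ft :: "'a \<Rightarrow> real \<Rightarrow> real"
    and gt :: "'a \<Rightarrow> real \<Rightarrow> 'a \<Rightarrow>\<^sub>L real"
    and L L0 \<epsilon> \<psi>min :: real
    and x0 :: 'a
    and M :: nat
    and s :: "'a apg_state"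
  assumes "finite_dimensional TYPE('a)"
    and "closed X" and "convex X"
    and "convex_on X h"
    and "prox_function X d d'"
    and "L > 0" and "inexact_oracle X f L ft gt"
    and "\<And>x. x \<in> X \<Longrightarrow> f x + h x \<ge> \<psi>min"
    and "x0 \<in> X" and "\<epsilon> > 0"
    and "0 < L0" and "L0 \<le> 2 * L"
    and "apg_reachable X h d d' ft gt \<epsilon> x0 L0 s"
  shows "(iter s = Suc M \<longrightarrow>
            (norm (coef s (best s) *\<^sub>R (pt s (best s) - pt s (Suc (best s)))))\<^sup>2
              \<le> 4 * L * (f x0 + h x0 - \<psi>min) / (real M + 1) + \<epsilon> / 2) \<and>
         real (repeated_passes s M) \<le> real M + log 2 (2 * L / L0)"
proof -
  interpret adaptive_projected_gradient X f h d d' ft gt L L0 \<epsilon> x0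
    by unfold_locales (fact assms)+
  show ?thesis
    using gradient_mapping_bound repeated_passes_bound assms(8,13) by blast
qed

end
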